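(* Let $p$ be a prime, let $m\ge 0$ be an integer, and let $f:\mathbb{Z}_p\to\mathbb{Z}_p$ be an analytic function of level $m$. Let $I'=\{\beta=(\beta_0,\dots,\beta_{m-1})\in\mathbb{Z}^m : 0\le\beta_0,\dots,\beta_{m-1}\le p-1\}$. Then there exists a unique restricted power series $F\in\mathbb{Z}_p[[x_0,x_1,\dots,x_m]]$ such that (1) $F(x_0,\dots,x_m)=\sum_{n\ge 0}\sum_{\beta\in I'} a_{\beta,n}\,x_0^{\beta_0}x_1^{\beta_1}\cdots x_{m-1}^{\beta_{m-1}}x_m^n$ for some $a_{\beta,n}\in\mathbb{Z}_p$ (i.e. every monomial of $F$ has degree at most $p-1$ in each of $x_0,\dots,x_{m-1}$), and (2) $f(a)=F(a,\delta a,\dots,\delta^m a)$ for all $a\in\mathbb{Z}_p$.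
   Context: $\mathbb{Z}_p$ denotes the ring of $p$-adic integers with the $p$-adic norm $|\cdot|_p$, $|p|_p=p^{-1}$. The Fermat quotient operator is $\delta:\mathbb{Z}_p\to\mathbb{Z}_p$, $\delta a=(a-a^p)/p$, and $\delta^i$ denotes its $i$-th iterate. A power series $F=\sum_{\alpha} a_\alpha x^\alpha\in\mathbb{Z}_p[[x_0,\dots,x_k]]$ is called restricted if $a_\alpha\to 0$ $p$-adically as $|\alpha|=\alpha_0+\dots+\alpha_k\to\infty$. A function $f:\mathbb{Z}_p\to\mathbb{Z}_p$ is analytic of level $m$ if for every $a\in\mathbb{Z}_p$ there is a restricted power series $F_a\in\mathbb{Z}_p[[x]]$ (one variable) such that $f(a+p^m u)=F_a(u)$ for all $u\in\mathbb{Z}_p$. For $m=0$, $I'$ consists of the single empty tuple and condition (1) says $F=\sum_n a_n x_0^n$. *)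

theory Defs
  imports Main "HOL-Computational_Algebra.Primes"
begin

text \<open>p-adic integers as coherent sequences of canonical residues:
  an element x of Z_p is represented by (x n) = its residue mod p^n in [0, p^n).\<close>

type_synonym zp = "nat \<Rightarrow> int"

definition Zp :: "int \<Rightarrow> zp set" where
  "Zp p = {x. \<forall>n. 0 \<le> x n \<and> x n < p ^ n \<and> x n = x (Suc n) mod p ^ n}"

definition zp_zero :: zp where "zp_zero = (\<lambda>n. 0)"

definition zp_of_int :: "int \<Rightarrow> int \<Rightarrow> zp" where
  "zp_of_int p z = (\<lambda>n. z mod p ^ n)"

definition zp_add :: "int \<Rightarrow> zp \<Rightarrow> zp \<Rightarrow> zp" where
  "zp_add p x y = (\<lambda>n. (x n + y n) mod p ^ n)"

definition zp_minus :: "int \<Rightarrow> zp \<Rightarrow> zp \<Rightarrow> zp" where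
  "zp_minus p x y = (\<lambda>n. (x n - y n) mod p ^ n)"

definition zp_mult :: "int \<Rightarrow> zp \<Rightarrow> zp \<Rightarrow> zp" where
  "zp_mult p x y = (\<lambda>n. (x n * y n) mod p ^ n)"

definition zp_pow :: "int \<Rightarrow> zp \<Rightarrow> nat \<Rightarrow> zp" where
  "zp_pow p x k = (\<lambda>n. (x n ^ k) mod p ^ n)"

text \<open>Exact division by p of an element divisible by p.\<close>
definition zp_divp :: "int \<Rightarrow> zp \<Rightarrow> zp" where
  "zp_divp p x = (\<lambda>n. x (Suc n) div p)"

definition delta :: "int \<Rightarrow> zp \<Rightarrow> zp" where
  "delta p a = zp_divp p (zp_minus p a (zp_pow p a (nat p)))"

text \<open>Power series over Z_p in variables x_0..x_k: coefficient function on
  exponent vectors (nat \<Rightarrow> nat); coefficients vanish on exponents involving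
  variables with index > k.\<close>
definition zp_series :: "int \<Rightarrow> nat \<Rightarrow> ((nat \<Rightarrow> nat) \<Rightarrow> zp) \<Rightarrow> bool" where
  "zp_series p k c \<longleftrightarrow> (\<forall>\<alpha>. c \<alpha> \<in> Zp p) \<and> (\<forall>\<alpha>. (\<exists>i>k. \<alpha> i \<noteq> 0) \<longrightarrow> c \<alpha> = zp_zero)"

text \<open>Restricted: coefficients tend to 0 p-adically, i.e. for every n only
  finitely many coefficients are nonzero modulo p^n.\<close>
definition restricted :: "((nat \<Rightarrow> nat) \<Rightarrow> zp) \<Rightarrow> bool" where
  "restricted c \<longleftrightarrow> (\<forall>n. finite {\<alpha>. c \<alpha> n \<noteq> 0})"

text \<open>Value of a restricted power series at a point x (x i = value of x_i):
  modulo p^n, the convergent sum reduces to the finite sum over the coefficients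
  nonzero modulo p^n.\<close>
definition zp_eval :: "int \<Rightarrow> ((nat \<Rightarrow> nat) \<Rightarrow> zp) \<Rightarrow> (nat \<Rightarrow> zp) \<Rightarrow> zp" where
  "zp_eval p c x = (\<lambda>n. (\<Sum>\<alpha>\<in>{\<alpha>. c \<alpha> n \<noteq> 0}. c \<alpha> n * (\<Prod>i\<in>{i. \<alpha> i \<noteq> 0}. x i n ^ \<alpha> i)) mod p ^ n)"

definition analytic_level :: "int \<Rightarrow> nat \<Rightarrow> (zp \<Rightarrow> zp) \<Rightarrow> bool" where
  "analytic_level p m f \<longleftrightarrow>
     (\<forall>a\<in>Zp p. \<exists>c. zp_series p 0 c \<and> restricted c \<and>
        (\<forall>u\<in>Zp p. f (zp_add p a (zp_mult p (zp_of_int p (p ^ m)) u)) = zp_eval p c (\<lambda>i. u)))"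

end

theory Submission
  imports Defs "HOL-Computational_Algebra.Polynomial" "HOL-Library.FuncSet"
begin

text \<open>
  On a disc \<open>r + p\<^sup>m \<int>\<^sub>p\<close> with coordinate \<open>u\<close>, each \<open>\<delta>\<^sup>i\<close> with \<open>i < m\<close> is a polynomial in \<open>u\<close>
  that is constant modulo \<open>p\<close>, while \<open>\<delta>\<^sup>m\<close> is congruent to \<open>u + \<delta>\<^sup>m r\<close>. Moreover
  \<open>r \<mapsto> (r, \<delta>r, \<dots>, \<delta>\<^sup>m\<^sup>-\<^sup>1r)\<close> modulo \<open>p\<close> identifies \<open>\<int>/p\<^sup>m\<close> with the points of the affine
  \<open>m\<close>-space over \<open>\<int>/p\<close>. Substituting these polynomials thus sends a polynomial of degree below
  \<open>p\<close> in \<open>x\<^sub>0, \<dots>, x\<^sub>m\<^sub>-\<^sub>1\<close> to one polynomial in \<open>u\<close> for each disc, and by Lagrange interpolation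
  this map is bijective modulo \<open>p\<close>, hence modulo every \<open>p\<^sup>n\<close>. Injectivity makes the solutions
  modulo \<open>p\<^sup>n\<close> fit together to a restricted series. Since an analytic function determines its power
  series on each disc, injectivity also gives uniqueness.
\<close>

section \<open>The Fermat quotient on the integers\<close>

text \<open>In the factorization of \<open>x ^ q - y ^ q\<close> by \<open>x - y\<close>, every
  summand of the cofactor is congruent to \<open>y ^ (q - 1)\<close> modulo \<open>q\<close>, so the
  cofactor, having \<open>q\<close> summands, is divisible by \<open>q\<close>. The general ring
  covers both integers and integer polynomials.\<close>

lemma power_diff_dvd_mult:
  fixes x y d :: "'a::comm_ring_1"
  assumes "of_nat q dvd d" "d dvd x - y"
  shows "d * of_nat q dvd x ^ q - y ^ q"
proof (cases q)
  case 0
  then show ?thesis by simp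
next
  case (Suc k)
  have "of_nat q dvd x - y"
    using assms by (rule dvd_trans)
  then have pow: "of_nat q dvd x ^ j - y ^ j" for j
    by (cases j) (simp_all only: diff_power_eq_sum dvd_mult2 power_0 diff_self dvd_0_right)
  have "of_nat q dvd (\<Sum>j<Suc k. x ^ j * y ^ (k - j) - y ^ k)"
  proof (rule dvd_sum)
    fix j assume "j \<in> {..<Suc k}"
    then have "y ^ k = y ^ j * y ^ (k - j)"
      by (simp flip: power_add)
    then have "x ^ j * y ^ (k - j) - y ^ k = (x ^ j - y ^ j) * y ^ (k - j)"
      by (simp add: algebra_simps)
    then show "of_nat q dvd x ^ j * y ^ (k - j) - y ^ k"
      using pow by simp
  qed
  then have "of_nat q dvd (\<Sum>j<Suc k. x ^ j * y ^ (k - j)) - of_nat q * y ^ k"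
    by (simp add: sum_subtractf Suc)
  then have "of_nat q dvd (\<Sum>j<Suc k. x ^ j * y ^ (k - j))"
    by (metis dvd_triv_left dvd_diff_left_iff)
  then show ?thesis
    using assms(2) by (simp only: Suc diff_power_eq_sum mult_dvd_mono)
qed

text \<open>Fermat's little theorem, by induction from 0 in both directions: the inner binomial
  coefficients vanish modulo \<open>p\<close>.\<close>

lemma prime_dvd_diff_power:
  fixes p a :: int
  assumes "prime p"
  shows "p dvd a - a ^ nat p"
proof -
  define q where "q = nat p"
  have p: "p = int q" and q: "prime q" "q > 0"
    using assms prime_gt_0_int[OF assms] by (auto simp: q_def)
  have step: "p dvd (x + 1) ^ q - x ^ q - 1" for x :: int
  proof -
    have "(x + 1) ^ q = (\<Sum>k\<le>q. of_nat (q choose k) * x ^ k)"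
      by (simp add: binomial_ring)
    also have "{..q} = insert 0 (insert q {0<..<q})"
      using q by auto
    finally have "(x + 1) ^ q - x ^ q - 1 = (\<Sum>k\<in>{0<..<q}. of_nat (q choose k) * x ^ k)"
      using q by simp
    also have "p dvd \<dots>"
      unfolding p by (intro dvd_sum dvd_mult2) (auto intro!: dvd_choose_prime q)
    finally show ?thesis .
  qed
  have "p dvd a - a ^ q"
  proof (induction a rule: int_induct[where k = 0])
    case base
    show ?case using q by (simp add: zero_power)
  next
    case (step1 i)
    have eq: "i + 1 - (i + 1) ^ q = (i - i ^ q) - ((i + 1) ^ q - i ^ q - 1)" by simp
    show ?case unfolding eq by (rule dvd_diff[OF step1(2) step])
  next
    case (step2 i)
    have eq: "i - 1 - (i - 1) ^ q = (i - i ^ q) + ((i - 1 + 1) ^ q - (i - 1) ^ q - 1)" by simp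
    show ?case unfolding eq by (rule dvd_add[OF step2(2) step])
  qed
  then show ?thesis by (simp add: q_def)
qed

lemma prime_dvd_power_pred_diff_1:
  fixes p a :: int
  assumes "prime p" "\<not> p dvd a"
  shows "p dvd a ^ (nat p - 1) - 1"
proof -
  have "a - a ^ nat p = - a * (a ^ (nat p - 1) - 1)"
    using prime_gt_0_int[OF assms(1)] by (simp add: algebra_simps flip: power_Suc)
  then have "p dvd a * (a ^ (nat p - 1) - 1)"
    by (metis assms(1) dvd_minus_iff minus_mult_left prime_dvd_diff_power)
  then show ?thesis
    using assms by (simp add: prime_dvd_mult_iff)
qed

text \<open>The integer model of \<open>delta\<close>: modulo \<open>p ^ n\<close>, p-adic
  computations are carried out with it.\<close>

definition fermat_quot :: "int \<Rightarrow> int \<Rightarrow> int" where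
  "fermat_quot p a = (a - a ^ nat p) div p"

lemma fermat_quot_mult:
  assumes "prime p"
  shows "p * fermat_quot p a = a - a ^ nat p"
  using prime_dvd_diff_power[OF assms] by (simp add: fermat_quot_def)

text \<open>Taking \<open>p\<close>-th powers preserves the congruence; the division by
  \<open>p\<close> costs one digit.\<close>

lemma fermat_quot_cong:
  assumes "prime p" "p ^ Suc n dvd a - b"
  shows "p ^ n dvd fermat_quot p a - fermat_quot p b"
proof -
  have p: "p > 0"
    using assms(1) by (rule prime_gt_0_int)
  have "p ^ Suc n * of_nat (nat p) dvd a ^ nat p - b ^ nat p"
    using p assms(2) by (intro power_diff_dvd_mult) auto
  then have "p ^ Suc n dvd a ^ nat p - b ^ nat p"
    by (rule dvd_mult_left)
  then have "p ^ Suc n dvd (a - b) - (a ^ nat p - b ^ nat p)"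
    using assms(2) by (rule dvd_diff[rotated])
  also have "\<dots> = p * (fermat_quot p a - fermat_quot p b)"
    by (simp add: right_diff_distrib fermat_quot_mult[OF assms(1)])
  finally show ?thesis
    using p by simp
qed

text \<open>Taking \<open>p\<close>-th powers sharpens a congruence by a factor \<open>p\<close>, so modulo higher order terms
  \<open>\<delta>\<close> acts on increments as division by \<open>p\<close>.\<close>

lemma fermat_quot_iterate_disc:
  assumes "prime p" "i \<le> k"
  shows "\<exists>H. \<forall>u. (fermat_quot p ^^ i) (a + p ^ k * u)
                 = (fermat_quot p ^^ i) a + p ^ (k - i) * (u + p * poly H u)"
  using assms(2)
proof (induction i)
  case 0
  show ?case by (rule exI[of _ 0]) simp
next
  case (Suc i)
  have p: "p > 0"
    using assms(1) by (rule prime_gt_0_int)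
  from Suc obtain H where H: "\<And>u. (fermat_quot p ^^ i) (a + p ^ k * u)
      = (fermat_quot p ^^ i) a + p ^ (k - i) * (u + p * poly H u)"
    by fastforce
  define j where "j = k - Suc i"
  have j: "k - i = Suc j"
    using Suc.prems by (simp add: j_def)
  define g where "g = (fermat_quot p ^^ i) a"
  \<comment> \<open>\<open>P\<close> is the \<open>i\<close>-th iterate as a polynomial in
    \<open>u\<close>. Comparing \<open>p\<close>-th powers in the polynomial ring, not pointwise,
    makes the correction \<open>S\<close> a polynomial too.\<close>
  define P where "P = [:g:] + smult (p ^ Suc j) ([:0, 1:] + smult p H)"
  have "[:p ^ Suc j:] * of_nat (nat p) dvd P ^ nat p - [:g:] ^ nat p"
  proof (rule power_diff_dvd_mult)
    show "of_nat (nat p) dvd [:p ^ Suc j:]"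
      using p by (simp add: of_nat_poly)
    have "P - [:g:] = [:p ^ Suc j:] * ([:0, 1:] + smult p H)"
      by (simp add: P_def)
    then show "[:p ^ Suc j:] dvd P - [:g:]"
      by (rule dvdI)
  qed
  then obtain S where S: "P ^ nat p - [:g:] ^ nat p = [:p ^ Suc j:] * of_nat (nat p) * S"
    by (auto simp: dvd_def)
  have Pu: "poly P u = g + p ^ Suc j * (u + p * poly H u)" for u
    by (simp add: P_def)
  have *: "poly P u ^ nat p = g ^ nat p + p * p ^ Suc j * poly S u" for u
    using arg_cong[OF S, of "\<lambda>Q. poly Q u"] p by (simp add: poly_power algebra_simps)
  show ?case
  proof (rule exI[of _ "H - S"], rule allI)
    fix u
    have "p * (fermat_quot p ^^ Suc i) (a + p ^ k * u) = poly P u - poly P u ^ nat p"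
      by (simp add: fermat_quot_mult[OF assms(1)] H j Pu flip: g_def)
    also have "\<dots> = p * ((fermat_quot p ^^ Suc i) a + p ^ j * (u + p * poly (H - S) u))"
      using fermat_quot_mult[OF assms(1), of g]
      by (simp only: *) (simp add: Pu algebra_simps flip: g_def)
    finally show "(fermat_quot p ^^ Suc i) (a + p ^ k * u)
      = (fermat_quot p ^^ Suc i) a + p ^ (k - Suc i) * (u + p * poly (H - S) u)"
      using p by (simp add: j_def)
  qed
qed

text \<open>Let \<open>p ^ k\<close> be the exact power of \<open>p\<close> in \<open>a - b\<close>.
  In the disc formula with \<open>i = k\<close> the increment has lost its whole factor
  \<open>p ^ k\<close>, so the \<open>k\<close>-th iterates differ modulo \<open>p\<close>.\<close>

lemma fermat_quot_iterates_separate: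
  assumes "prime p" "a \<in> {0..<p ^ m}" "b \<in> {0..<p ^ m}" "a \<noteq> b"
  shows "\<exists>i<m. \<not> p dvd (fermat_quot p ^^ i) a - (fermat_quot p ^^ i) b"
proof -
  have p: "p > 0" "p > 1"
    using assms(1) by (auto simp: prime_gt_0_int prime_gt_1_int)
  obtain k w where kw: "a - b = p ^ k * w" "\<not> p dvd w"
    using assms(4) p multiplicity_decompose'[of "a - b" p]
    by (metis abs_of_pos eq_iff_diff_eq_0 less_irrefl not_prime_unit assms(1))
  have "k < m"
  proof (rule ccontr)
    assume "\<not> k < m"
    then have "p ^ m dvd a - b"
      unfolding kw by (simp add: le_imp_power_dvd)
    with assms show False
      by (metis atLeastLessThan_iff mod_eq_dvd_iff mod_pos_pos_trivial)
  qed
  obtain H where "\<And>u. (fermat_quot p ^^ k) (b + p ^ k * u)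
      = (fermat_quot p ^^ k) b + p ^ (k - k) * (u + p * poly H u)"
    using fermat_quot_iterate_disc[OF assms(1) order_refl] by blast
  from this[of w] kw(1) have "(fermat_quot p ^^ k) a - (fermat_quot p ^^ k) b = w + p * poly H w"
    by (simp add: algebra_simps)
  with kw(2) dvd_add_times_triv_right_iff[of p w "poly H w"]
  have "\<not> p dvd (fermat_quot p ^^ k) a - (fermat_quot p ^^ k) b"
    by (simp add: mult.commute)
  with \<open>k < m\<close> show ?thesis by blast
qed

section \<open>Congruences between polynomials\<close>

text \<open>Congruences keep the form \<open>d dvd a - b\<close>, so that the same rules serve
  integers modulo \<open>p ^ n\<close> and integer polynomials modulo the constant
  \<open>[:p ^ n:]\<close>.\<close>

lemma dvd_diff_trans:
  fixes d :: "'a::comm_ring_1"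
  shows "d dvd a - b \<Longrightarrow> d dvd b - c \<Longrightarrow> d dvd a - c"
  using dvd_add[of d "a - b" "b - c"] by simp

lemma dvd_diff_mult:
  fixes d :: "'a::comm_ring_1"
  assumes "d dvd a - b" "d dvd a' - b'"
  shows "d dvd a * a' - b * b'"
proof -
  have "a * a' - b * b' = (a - b) * a' + b * (a' - b')"
    by (simp add: algebra_simps)
  with assms show ?thesis by simp
qed

lemma dvd_diff_power:
  fixes d :: "'a::comm_ring_1"
  assumes "d dvd a - b"
  shows "d dvd a ^ n - b ^ n"
  by (induction n) (use assms in \<open>auto intro: dvd_diff_mult\<close>)

lemma dvd_diff_prod:
  fixes d :: "'a::comm_ring_1"
  assumes "\<And>i. i \<in> A \<Longrightarrow> d dvd f i - g i"
  shows "d dvd prod f A - prod g A"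
  using assms by (induction A rule: infinite_finite_induct) (auto intro: dvd_diff_mult)

lemma dvd_diff_sum:
  fixes d :: "'a::comm_ring_1"
  assumes "\<And>i. i \<in> A \<Longrightarrow> d dvd f i - g i"
  shows "d dvd sum f A - sum g A"
  using assms by (auto intro!: dvd_sum simp flip: sum_subtractf)

lemma const_dvd_pcompose:
  fixes c :: "'a::comm_semiring_1"
  assumes "[:c:] dvd q"
  shows "[:c:] dvd pcompose q r"
  using assms by (metis dvd_def pcompose_const pcompose_mult)

lemma const_dvd_poly:
  fixes c :: "'a::comm_semiring_1"
  assumes "[:c:] dvd q"
  shows "c dvd poly q x"
  using assms by (auto simp: dvd_def)

lemma pcompose_shift_shift:
  fixes q :: "'a::comm_ring_1 poly"
  shows "pcompose (pcompose q [:a, 1:]) [:- a, 1:] = q"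
    and "pcompose (pcompose q [:- a, 1:]) [:a, 1:] = q"
  by (simp_all add: pcompose_pCons flip: pcompose_assoc)

text \<open>\<open>R n\<close> plays the role of a restricted power series over \<open>\<int>\<^sub>p\<close> reduced modulo
  \<open>p\<^sup>n\<close>. If the coefficients below the \<open>k\<close>-th vanish, evaluating at \<open>p\<^sup>n\<close> shows that \<open>p\<^sup>n\<close> divides
  the \<open>k\<close>-th one.\<close>

lemma coherent_polys_identity:
  fixes R :: "nat \<Rightarrow> int poly" and p :: int
  assumes p: "p > 0"
    and coherent: "\<And>n. [:p ^ n:] dvd R (Suc n) - R n"
    and vanish: "\<And>n x. p ^ n dvd poly (R n) x"
  shows "[:p ^ n:] dvd R n"
proof -
  have coherent': "[:p ^ n:] dvd R N - R n" if "n \<le> N" for n N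
    using that
  proof (induction N rule: dec_induct)
    case (step N)
    have "[:p ^ n:] dvd [:p ^ N:]"
      using step by (simp add: le_imp_power_dvd)
    then have "[:p ^ n:] dvd R (Suc N) - R N"
      using coherent by (rule dvd_trans)
    then show ?case
      using step.IH by (rule dvd_diff_trans)
  qed simp
  have "p ^ n dvd coeff (R n) k" for n k
  proof (induction k arbitrary: n rule: less_induct)
    case (less k)
    \<comment> \<open>At precision \<open>N\<close> the value at \<open>x = p ^ n\<close> and the
      coefficients below the \<open>k\<close>-th vanish modulo \<open>x ^ Suc k\<close>; cancelling
      \<open>x ^ k\<close> leaves one factor \<open>p ^ n\<close> for the \<open>k\<close>-th
      coefficient.\<close>
    define N where "N = n * Suc k + n"
    define x where "x = p ^ n"
    have x: "x > 0" using p by (simp add: x_def)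
    have xN: "x ^ Suc k dvd p ^ N"
      unfolding x_def N_def power_mult[symmetric] by (rule le_imp_power_dvd) simp
    obtain S where S: "R N = (\<Sum>j\<le>k. monom (coeff (R N) j) j) + monom 1 (Suc k) * S"
    proof -
      have "coeff (R N - (\<Sum>j\<le>k. monom (coeff (R N) j) j)) i = 0" if "i < Suc k" for i
        using that by (simp add: coeff_sum)
      then have "monom 1 (Suc k) dvd R N - (\<Sum>j\<le>k. monom (coeff (R N) j) j)"
        by (simp add: monom_1_dvd_iff')
      then show thesis using that
        by (metis (no_types, lifting) add.commute diff_eq_eq dvd_def)
    qed
    have "poly (R N) x = (\<Sum>j\<le>k. coeff (R N) j * x ^ j) + x ^ Suc k * poly S x"
      by (subst S) (simp add: poly_sum poly_monom)
    also have "(\<Sum>j\<le>k. coeff (R N) j * x ^ j)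
        = (\<Sum>j<k. coeff (R N) j * x ^ j) + coeff (R N) k * x ^ k"
      by (simp flip: lessThan_Suc_atMost)
    finally have "coeff (R N) k * x ^ k
        = poly (R N) x - (\<Sum>j<k. coeff (R N) j * x ^ j) - x ^ Suc k * poly S x"
      by simp
    also have "x ^ Suc k dvd \<dots>"
    proof (intro dvd_diff dvd_sum)
      show "x ^ Suc k dvd poly (R N) x"
        using xN vanish by (rule dvd_trans)
      show "x ^ Suc k dvd coeff (R N) j * x ^ j" if "j \<in> {..<k}" for j
        using that less.IH dvd_trans[OF xN] by (intro dvd_mult2) auto
    qed simp
    finally have "p ^ n dvd coeff (R N) k"
      using p by (simp add: x_def)
    moreover have "p ^ n dvd coeff (R N) k - coeff (R n) k"
      using coherent'[of n N] by (simp add: N_def const_poly_dvd_iff)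
    ultimately show ?case
      using dvd_diff[of "p ^ n" "coeff (R N) k" "coeff (R N) k - coeff (R n) k"] by simp
  qed
  then show ?thesis by (simp add: const_poly_dvd_iff)
qed

section \<open>Bijectivity of the substitution map modulo powers of \<open>p\<close>\<close>

text \<open>The polynomial \<open>G r i\<close> stands for \<open>\<delta>\<^sup>i\<close> on the disc \<open>r + p\<^sup>m\<int>\<^sub>p\<close>, in the disc coordinate.\<close>

locale disc_charts =
  fixes p :: int and m :: nat and R :: "int set"
    and G :: "int \<Rightarrow> nat \<Rightarrow> int poly" and g :: "int \<Rightarrow> nat \<Rightarrow> int"
  assumes prime: "prime p"
    and R_def: "R = {0..<p ^ m}"
    and chart_const: "r \<in> R \<Longrightarrow> i < m \<Longrightarrow> [:p:] dvd G r i - [:g r i:]"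
    and chart_top: "r \<in> R \<Longrightarrow> [:p:] dvd G r m - [:g r m, 1:]"
    and separate: "r \<in> R \<Longrightarrow> s \<in> R \<Longrightarrow> r \<noteq> s \<Longrightarrow> \<exists>i<m. \<not> p dvd g r i - g s i"
begin

text \<open>The index set \<open>I'\<close>. Extensionality gives each tuple one representative, so
  there are \<open>p ^ m\<close> of them.\<close>

definition B :: "(nat \<Rightarrow> nat) set" where
  "B = (\<Pi>\<^sub>E i\<in>{..<m}. {..<nat p})"

text \<open>Modulo \<open>p\<close> the first \<open>m\<close> variables are constant on a disc;
  this is the value there of the polynomial with coefficients \<open>e\<close>.\<close>

definition reduced_value :: "((nat \<Rightarrow> nat) \<Rightarrow> int) \<Rightarrow> int \<Rightarrow> int" where
  "reduced_value e r = (\<Sum>\<beta>\<in>B. e \<beta> * (\<Prod>i<m. g r i ^ \<beta> i))"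

text \<open>Substitution of the charts of disc \<open>r\<close> into a series truncated at degree
  \<open>K\<close> in the last variable; \<open>e n \<beta>\<close> is the coefficient of the
  monomial with exponents \<open>\<beta>\<close> and \<open>n\<close>.\<close>

definition chart_subst :: "nat \<Rightarrow> (nat \<Rightarrow> (nat \<Rightarrow> nat) \<Rightarrow> int) \<Rightarrow> int \<Rightarrow> int poly" where
  "chart_subst K e r = (\<Sum>n\<le>K. \<Sum>\<beta>\<in>B. [:e n \<beta>:] * ((\<Prod>i<m. G r i ^ \<beta> i) * G r m ^ n))"

lemma p_pos: "p > 0"
  using prime by (rule prime_gt_0_int)

lemma finite_B: "finite B" and finite_R: "finite R"
  by (auto simp: B_def R_def intro: finite_PiE)

text \<open>By Fermat, each factor is modulo \<open>p\<close> the indicator of agreement in one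
  coordinate, and distinct discs disagree in some coordinate.\<close>

lemma indicator_mod_p:
  assumes "r \<in> R" "s \<in> R"
  shows "p dvd (\<Prod>i<m. 1 - (g r i - g s i) ^ (nat p - 1)) - of_bool (r = s)"
proof (cases "r = s")
  case True
  have "nat p - 1 > 0"
    using prime_gt_1_int[OF prime] by simp
  with True show ?thesis by (simp add: zero_power)
next
  case False
  with assms obtain i where i: "i < m" "\<not> p dvd g r i - g s i"
    using separate by blast
  then have "p dvd 1 - (g r i - g s i) ^ (nat p - 1)"
    using prime_dvd_power_pred_diff_1[OF prime] by (subst dvd_diff_commute)
  also have "\<dots> dvd (\<Prod>i<m. 1 - (g r i - g s i) ^ (nat p - 1))"
    using i by (intro dvd_prodI) auto
  finally show ?thesis
    using False by simp
qed

text \<open>Lagrange interpolation modulo \<open>p\<close>: each coordinate indicator has degree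
  below \<open>p\<close>, so its products expand into monomials with exponents in
  \<open>B\<close>.\<close>

lemma interpolation_exists: "\<exists>e. \<forall>r\<in>R. p dvd reduced_value e r - y r"
proof -
  define L where "L s i = 1 - [:- g s i, 1:] ^ (nat p - 1)" for s i
  have degL: "degree (L s i) < nat p" for s i
  proof -
    have "degree (L s i) \<le> nat p - 1"
      unfolding L_def
      by (intro degree_diff_le order.trans[OF degree_power_le]) auto
    then show ?thesis
      using p_pos by linarith
  qed
  have polyL: "poly (L s i) x = (\<Sum>j<nat p. coeff (L s i) j * x ^ j)" for s i x
    unfolding poly_altdef using degL[of s i]
    by (intro sum.mono_neutral_left) (auto simp: coeff_eq_0)
  \<comment> \<open>The coefficients obtained by multiplying out the sum over \<open>s\<close> of
    \<open>y s\<close> times the product of the \<open>L s i\<close> in the variables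
    \<open>x_i\<close>.\<close>
  define e where "e \<beta> = (\<Sum>s\<in>R. y s * (\<Prod>i<m. coeff (L s i) (\<beta> i)))" for \<beta>
  have "reduced_value e r = (\<Sum>s\<in>R. y s * (\<Prod>i<m. 1 - (g r i - g s i) ^ (nat p - 1)))" for r
  proof -
    have "reduced_value e r
        = (\<Sum>s\<in>R. y s * (\<Sum>\<beta>\<in>B. \<Prod>i<m. coeff (L s i) (\<beta> i) * g r i ^ \<beta> i))"
      unfolding reduced_value_def e_def sum_distrib_right sum_distrib_left
      by (subst sum.swap) (simp add: prod.distrib mult_ac)
    also have "\<dots> = (\<Sum>s\<in>R. y s * (\<Prod>i<m. poly (L s i) (g r i)))"
      unfolding B_def polyL by (subst prod_sum_PiE) auto
    finally show ?thesis
      by (simp add: L_def poly_power)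
  qed
  moreover have "p dvd (\<Sum>s\<in>R. y s * (\<Prod>i<m. 1 - (g r i - g s i) ^ (nat p - 1))) - y r"
    if "r \<in> R" for r
  proof -
    have "y r = (\<Sum>s\<in>R. y s * of_bool (r = s))"
      using that finite_R by (simp add: of_bool_def if_distrib cong: if_cong)
    then show ?thesis
      using indicator_mod_p[OF that]
      by (auto intro!: dvd_diff_sum dvd_diff_mult)
  qed
  ultimately show ?thesis by metis
qed

text \<open>Interpolation is surjective between finite sets of the same size \<open>p\<close> to the \<open>p\<^sup>m\<close>, hence
  injective.\<close>

lemma interpolation_unique:
  assumes "\<And>r. r \<in> R \<Longrightarrow> p dvd reduced_value e r" "\<beta> \<in> B"
  shows "p dvd e \<beta>"
proof -
  define X where "X = (\<Pi>\<^sub>E b\<in>B. {0..<p})"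
  define Y where "Y = (\<Pi>\<^sub>E r\<in>R. {0..<p})"
  define t where "t e = (\<lambda>r\<in>R. reduced_value e r mod p)" for e
  have fin: "finite X" "finite Y"
    unfolding X_def Y_def by (auto intro!: finite_PiE finite_B finite_R)
  have "card R = card B"
    using p_pos by (simp add: R_def B_def card_PiE nat_power_eq)
  then have card: "card X = card Y"
    by (simp add: X_def Y_def card_PiE finite_R finite_B)
  \<comment> \<open>\<open>t\<close> sees coefficients only modulo \<open>p\<close>, so injectivity
    on the canonical representatives in \<open>X\<close> settles every \<open>e\<close>.\<close>
  have t_mod: "t (\<lambda>b\<in>B. e b mod p) = t e" for e
  proof -
    have "p dvd reduced_value (\<lambda>b\<in>B. e b mod p) r - reduced_value e r" for r
      unfolding reduced_value_def
      by (intro dvd_diff_sum dvd_diff_mult) (auto simp: mod_eq_dvd_iff[symmetric])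
    then show ?thesis
      by (auto simp: t_def mod_eq_dvd_iff)
  qed
  have "t ` X = Y"
  proof (intro equalityI subsetI)
    fix y assume "y \<in> t ` X"
    then show "y \<in> Y"
      using p_pos by (auto simp: t_def Y_def)
  next
    fix y assume y: "y \<in> Y"
    obtain e where e: "\<And>r. r \<in> R \<Longrightarrow> p dvd reduced_value e r - y r"
      using interpolation_exists by blast
    have "t e = y"
    proof
      fix r
      show "t e r = y r"
      proof (cases "r \<in> R")
        case True
        with y have "y r mod p = y r"
          by (auto simp: Y_def PiE_iff)
        with True e[OF True] show ?thesis
          by (simp add: t_def mod_eq_dvd_iff[symmetric])
      next
        case False
        with y show ?thesis
          by (auto simp: Y_def t_def PiE_iff extensional_def)
      qed
    qed
    moreover have "(\<lambda>b\<in>B. e b mod p) \<in> X"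
      using p_pos by (auto simp: X_def)
    ultimately show "y \<in> t ` X"
      using t_mod by (metis imageI)
  qed
  with card fin have inj: "inj_on t X"
    by (intro eq_card_imp_inj_on) auto
  have "t e = t (\<lambda>b. 0)"
    using assms(1) by (auto simp: t_def reduced_value_def)
  then have "t (\<lambda>b\<in>B. e b mod p) = t (\<lambda>b\<in>B. 0 mod p)"
    by (simp only: t_mod)
  then have "(\<lambda>b\<in>B. e b mod p) = (\<lambda>b\<in>B. 0 mod p)"
    by (rule inj_onD[OF inj]) (use p_pos in \<open>auto simp: X_def\<close>)
  with assms(2) show ?thesis
    by (metis mod_0 mod_eq_0_iff_dvd restrict_apply')
qed

text \<open>Modulo \<open>p\<close> the charts below \<open>m\<close> are constants and the top one
  is a translation. Up to this translation, substitution is interpolation separately for each power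
  of the last variable.\<close>

lemma chart_subst_mod_p:
  assumes "r \<in> R"
  shows "[:p:] dvd chart_subst K e r
           - pcompose (\<Sum>n\<le>K. monom (reduced_value (e n) r) n) [:g r m, 1:]"
proof -
  have eq: "pcompose (\<Sum>n\<le>K. monom (reduced_value (e n) r) n) [:g r m, 1:]
      = (\<Sum>n\<le>K. \<Sum>\<beta>\<in>B. [:e n \<beta>:] * ((\<Prod>i<m. [:g r i:] ^ \<beta> i) * [:g r m, 1:] ^ n))"
  proof -
    have const_sum: "[:\<Sum>\<beta>\<in>B. h \<beta>:] = (\<Sum>\<beta>\<in>B. [:h \<beta>:])" for h :: "(nat \<Rightarrow> nat) \<Rightarrow> int"
      by (rule poly_eqI) (auto simp: coeff_sum coeff_pCons split: nat.splits)
    have const_prod: "(\<Prod>i\<in>A. [:h i:] ^ k i) = [:\<Prod>i\<in>A. h i ^ k i:]"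
      for h :: "nat \<Rightarrow> int" and k :: "nat \<Rightarrow> nat" and A
      by (induction A rule: infinite_finite_induct) (auto simp: poly_const_pow mult_ac simp flip: one_pCons)
    have "pcompose (monom a n) q = [:a:] * q ^ n" for a n and q :: "int poly"
      by (induction n) (auto simp: monom_0 monom_Suc pcompose_pCons mult_ac)
    then have "pcompose (\<Sum>n\<le>K. monom (reduced_value (e n) r) n) [:g r m, 1:]
        = (\<Sum>n\<le>K. [:reduced_value (e n) r:] * [:g r m, 1:] ^ n)"
      by (simp add: pcompose_sum)
    also have "\<dots> = (\<Sum>n\<le>K. \<Sum>\<beta>\<in>B. [:e n \<beta>:] * ((\<Prod>i<m. [:g r i:] ^ \<beta> i) * [:g r m, 1:] ^ n))"
      unfolding reduced_value_def const_sum const_prod sum_distrib_right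
      by (intro sum.cong refl) (simp add: mult.commute)
    finally show ?thesis .
  qed
  show ?thesis
    unfolding chart_subst_def eq using chart_const chart_top assms
    by (intro dvd_diff_sum dvd_diff_mult dvd_diff_prod dvd_diff_power) auto
qed

section \<open>Dependence of the substitution on truncation and coefficients\<close>

lemma chart_subst_mono:
  assumes "K \<le> K'" "\<And>n \<beta>. n > K \<Longrightarrow> e n \<beta> = 0"
  shows "chart_subst K' e r = chart_subst K e r"
  unfolding chart_subst_def using assms
  by (intro sum.mono_neutral_right) auto

lemma chart_subst_diff: "chart_subst K (\<lambda>n \<beta>. e n \<beta> - e' n \<beta>) r = chart_subst K e r - chart_subst K e' r"
  unfolding chart_subst_def sum_subtractf[symmetric] left_diff_distrib[symmetric] by simp

lemma chart_subst_add_mult: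
  "chart_subst K (\<lambda>n \<beta>. e n \<beta> + c * e' n \<beta>) r = chart_subst K e r + [:c:] * chart_subst K e' r"
  unfolding chart_subst_def sum_distrib_left sum.distrib[symmetric]
  by (intro sum.cong refl) (simp add: smult_add_left mult.commute)

lemma chart_subst_cong_dvd:
  assumes "\<And>n \<beta>. n \<le> K \<Longrightarrow> \<beta> \<in> B \<Longrightarrow> c dvd e n \<beta> - e' n \<beta>"
  shows "[:c:] dvd chart_subst K e r - chart_subst K e' r"
  unfolding chart_subst_def using assms
  by (intro dvd_diff_sum dvd_diff_mult) auto

lemma chart_subst_injective_mod_p:
  assumes "\<And>r. r \<in> R \<Longrightarrow> [:p:] dvd chart_subst K e r" "n \<le> K" "\<beta> \<in> B"
  shows "p dvd e n \<beta>"
proof (rule interpolation_unique[where e = "e n"])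
  fix r assume r: "r \<in> R"
  define V where "V = (\<Sum>n\<le>K. monom (reduced_value (e n) r) n)"
  have "[:p:] dvd pcompose V [:g r m, 1:]"
    using chart_subst_mod_p[OF r, of K e] assms(1)[OF r]
    unfolding V_def by (metis dvd_diff_right_iff)
  then have "[:p:] dvd V"
    by (metis const_dvd_pcompose pcompose_shift_shift(1))
  then have "p dvd coeff V n"
    by (simp add: const_poly_dvd_iff)
  also have "coeff V n = reduced_value (e n) r"
    using assms(2) by (simp add: V_def coeff_sum)
  finally show "p dvd reduced_value (e n) r" .
qed fact

text \<open>The case modulo \<open>p\<close> makes all coefficients divisible by \<open>p\<close>;
  by linearity one factor \<open>p\<close> cancels and the exponent drops.\<close>

lemma chart_subst_injective:
  assumes "\<And>r. r \<in> R \<Longrightarrow> [:p ^ N:] dvd chart_subst K e r" "n \<le> K" "\<beta> \<in> B"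
  shows "p ^ N dvd e n \<beta>"
  using assms
proof (induction N arbitrary: e)
  case (Suc N)
  have "[:p:] dvd chart_subst K e r" if "r \<in> R" for r
    using Suc.prems(1)[OF that] by (rule dvd_trans[rotated]) simp
  then have e: "p dvd e n \<beta>" if "n \<le> K" "\<beta> \<in> B" for n \<beta>
    using chart_subst_injective_mod_p that by blast
  define e' where "e' n \<beta> = e n \<beta> div p" for n \<beta>
  have "chart_subst K e r = [:p:] * chart_subst K e' r" for r
    unfolding chart_subst_def sum_distrib_left
    by (intro sum.cong refl) (simp add: e e'_def flip: mult.assoc)
  moreover have "[:p ^ Suc N:] = [:p:] * [:p ^ N:]"
    by simp
  ultimately have "[:p ^ N:] dvd chart_subst K e' r" if "r \<in> R" for r
    using Suc.prems(1)[OF that] p_pos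
    by (metis dvd_mult_cancel_left less_irrefl pCons_eq_0_iff)
  then have "p ^ N dvd e' n \<beta>"
    using Suc by blast
  then have "p * p ^ N dvd p * e' n \<beta>"
    by simp
  then show ?case
    using e[OF Suc.prems(2,3)] by (simp add: e'_def)
qed simp

text \<open>After translating each \<open>q r\<close> to the coordinate \<open>u + g r m\<close>,
  its coefficients are interpolated degree by degree, up to a degree bound common to the finitely
  many discs.\<close>

lemma chart_subst_surjective_mod_p:
  "\<exists>K e. (\<forall>n>K. \<forall>\<beta>. e n \<beta> = 0) \<and> (\<forall>r\<in>R. [:p:] dvd q r - chart_subst K e r)"
proof -
  define w where "w r = pcompose (q r) [:- g r m, 1:]" for r
  define K where "K = Max (insert 0 ((\<lambda>r. degree (w r)) ` R))"
  have K: "degree (w r) \<le> K" if "r \<in> R" for r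
    unfolding K_def using that finite_R by (intro Max_ge) auto
  obtain e0 where e0: "\<And>n r. r \<in> R \<Longrightarrow> p dvd reduced_value (e0 n) r - coeff (w r) n"
  proof -
    have "\<forall>n. \<exists>e. \<forall>r\<in>R. p dvd reduced_value e r - coeff (w r) n"
      by (intro allI interpolation_exists)
    then show thesis
      using that by metis
  qed
  define e where "e n = (if n \<le> K then e0 n else (\<lambda>\<beta>. 0))" for n
  have "[:p:] dvd q r - chart_subst K e r" if r: "r \<in> R" for r
  proof -
    define V where "V = (\<Sum>n\<le>K. monom (reduced_value (e n) r) n)"
    have "p dvd coeff (w r - V) n" for n
    proof (cases "n \<le> K")
      case True
      then have "coeff (w r - V) n = coeff (w r) n - reduced_value (e0 n) r"
        by (simp add: V_def coeff_sum e_def)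
      with e0[OF r, of n] show ?thesis by (metis dvd_diff_commute)
    next
      case False
      then have "coeff (w r - V) n = 0"
        using K[OF r] by (simp add: V_def coeff_sum coeff_eq_0)
      then show ?thesis by simp
    qed
    then have "[:p:] dvd w r - V"
      by (simp add: const_poly_dvd_iff)
    then have "[:p:] dvd pcompose (w r) [:g r m, 1:] - pcompose V [:g r m, 1:]"
      by (metis const_dvd_pcompose pcompose_diff)
    then have "[:p:] dvd q r - pcompose V [:g r m, 1:]"
      by (simp only: w_def pcompose_shift_shift)
    moreover have "[:p:] dvd pcompose V [:g r m, 1:] - chart_subst K e r"
      using chart_subst_mod_p[OF r, of K e] unfolding V_def by (subst (asm) dvd_minus_iff[symmetric]) (simp only: minus_diff_eq)
    ultimately show ?thesis
      by (rule dvd_diff_trans)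
  qed
  moreover have "\<forall>n>K. \<forall>\<beta>. e n \<beta> = 0"
    by (simp add: e_def)
  ultimately show ?thesis by blast
qed

text \<open>Successive approximation: solve modulo \<open>p\<close>, divide the error by
  \<open>p\<close>, and solve for the quotient modulo \<open>p ^ N\<close>.\<close>

lemma chart_subst_surjective:
  "\<exists>K e. (\<forall>n>K. \<forall>\<beta>. e n \<beta> = 0) \<and> (\<forall>r\<in>R. [:p ^ N:] dvd q r - chart_subst K e r)"
proof (induction N arbitrary: q)
  case 0
  show ?case by (rule exI[of _ 0], rule exI[of _ "\<lambda>_ _. 0"]) (simp flip: one_pCons)
next
  case (Suc N)
  obtain K1 e1 where 1: "\<And>n \<beta>. n > K1 \<Longrightarrow> e1 n \<beta> = 0"
      "\<And>r. r \<in> R \<Longrightarrow> [:p:] dvd q r - chart_subst K1 e1 r"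
    using chart_subst_surjective_mod_p by blast
  define s where "s r = (SOME s. q r - chart_subst K1 e1 r = [:p:] * s)" for r
  have s: "q r - chart_subst K1 e1 r = [:p:] * s r" if "r \<in> R" for r
    unfolding s_def using 1(2)[OF that] by (rule someI_ex[OF dvd_def[THEN iffD1]])
  obtain K2 e2 where 2: "\<And>n \<beta>. n > K2 \<Longrightarrow> e2 n \<beta> = 0"
      "\<And>r. r \<in> R \<Longrightarrow> [:p ^ N:] dvd s r - chart_subst K2 e2 r"
    using Suc[of s] by blast
  define K where "K = max K1 K2"
  define e where "e = (\<lambda>n \<beta>. e1 n \<beta> + p * e2 n \<beta>)"
  have "[:p ^ Suc N:] dvd q r - chart_subst K e r" if "r \<in> R" for r
  proof -
    have "chart_subst K e r = chart_subst K1 e1 r + [:p:] * chart_subst K2 e2 r"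
    proof -
      have "chart_subst K e1 r = chart_subst K1 e1 r"
        by (rule chart_subst_mono) (use 1(1) in \<open>auto simp: K_def\<close>)
      moreover have "chart_subst K e2 r = chart_subst K2 e2 r"
        by (rule chart_subst_mono) (use 2(1) in \<open>auto simp: K_def\<close>)
      ultimately show ?thesis
        by (simp only: e_def chart_subst_add_mult)
    qed
    then have "q r - chart_subst K e r = [:p:] * (s r - chart_subst K2 e2 r)"
      using s[OF that] by (simp only: right_diff_distrib diff_diff_eq)
    moreover have "[:p ^ Suc N:] = [:p:] * [:p ^ N:]"
      by simp
    ultimately show ?thesis
      using 2(2)[OF that] by (simp only: mult_dvd_mono dvd_refl)
  qed
  moreover have "\<forall>n>K. \<forall>\<beta>. e n \<beta> = 0"
    using 1(1) 2(1) by (simp add: K_def e_def)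
  ultimately show ?case by blast
qed

text \<open>The solutions are chosen independently for each \<open>N\<close>. Once they are reduced
  to canonical residues, injectivity forces each to be the reduction of the next.\<close>

lemma chart_subst_surjective_coherent:
  assumes "\<And>N r. r \<in> R \<Longrightarrow> [:p ^ N:] dvd Q (Suc N) r - Q N r"
  shows "\<exists>K e. \<forall>N.
     (\<forall>n \<beta>. e N n \<beta> \<in> {0..<p ^ N}) \<and>
     (\<forall>n>K N. \<forall>\<beta>. e N n \<beta> = 0) \<and>
     (\<forall>n. \<forall>\<beta>\<in>B. e N n \<beta> = e (Suc N) n \<beta> mod p ^ N) \<and>
     (\<forall>r\<in>R. [:p ^ N:] dvd Q N r - chart_subst (K N) (e N) r)"
proof -
  have "\<forall>N. \<exists>K e. (\<forall>n>K. \<forall>\<beta>. e n \<beta> = 0) \<and> (\<forall>r\<in>R. [:p ^ N:] dvd Q N r - chart_subst K e r)"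
    by (intro allI chart_subst_surjective)
  then obtain K e0 where K: "\<And>N n \<beta>. n > K N \<Longrightarrow> e0 N n \<beta> = (0::int)"
    and Q0: "\<And>N r. r \<in> R \<Longrightarrow> [:p ^ N:] dvd Q N r - chart_subst (K N) (e0 N) r"
    by metis
  define e where "e N n \<beta> = e0 N n \<beta> mod p ^ N" for N n \<beta>
  have range: "e N n \<beta> \<in> {0..<p ^ N}" for N n \<beta>
    using p_pos by (simp add: e_def)
  have zero: "e N n \<beta> = 0" if "n > K N" for N n \<beta>
    using K[OF that] by (simp add: e_def)
  have Q: "[:p ^ N:] dvd Q N r - chart_subst (K N) (e N) r" if "r \<in> R" for N r
    by (rule dvd_diff_trans[OF Q0[OF that] chart_subst_cong_dvd])
      (simp add: e_def flip: mod_eq_dvd_iff)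
  have "e N n \<beta> = e (Suc N) n \<beta> mod p ^ N" if \<beta>: "\<beta> \<in> B" for N n \<beta>
  proof -
    \<comment> \<open>A truncation common to both precisions, also covering the index
      \<open>n\<close> under comparison.\<close>
    define K' where "K' = Max {K N, K (Suc N), n}"
    have "[:p ^ N:] dvd chart_subst K' (\<lambda>n \<beta>. e (Suc N) n \<beta> - e N n \<beta>) r" if r: "r \<in> R" for r
    proof -
      have "[:p ^ N:] dvd [:p ^ Suc N:]"
        by simp
      then have "[:p ^ N:] dvd Q (Suc N) r - chart_subst (K (Suc N)) (e (Suc N)) r"
        using Q[OF r] by (rule dvd_trans)
      also have "chart_subst (K (Suc N)) (e (Suc N)) r = chart_subst K' (e (Suc N)) r"
        by (rule chart_subst_mono[symmetric]) (use zero in \<open>auto simp: K'_def\<close>)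
      finally have "[:p ^ N:] dvd Q (Suc N) r - chart_subst K' (e (Suc N)) r" .
      moreover have "chart_subst (K N) (e N) r = chart_subst K' (e N) r"
        by (rule chart_subst_mono[symmetric]) (use zero in \<open>auto simp: K'_def\<close>)
      then have "[:p ^ N:] dvd Q N r - chart_subst K' (e N) r"
        using Q[OF r, of N] by simp
      ultimately have "[:p ^ N:] dvd (Q (Suc N) r - Q N r)
          - (Q (Suc N) r - chart_subst K' (e (Suc N)) r) + (Q N r - chart_subst K' (e N) r)"
        using assms[OF r, of N] by (simp only: dvd_add dvd_diff)
      then show ?thesis
        by (simp add: chart_subst_diff)
    qed
    then have "p ^ N dvd e (Suc N) n \<beta> - e N n \<beta>"
      by (rule chart_subst_injective[where e = "\<lambda>n \<beta>. e (Suc N) n \<beta> - e N n \<beta>"])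
        (use \<beta> in \<open>auto simp: K'_def\<close>)
    then show ?thesis
      using range[of N n \<beta>] by (simp flip: mod_eq_dvd_iff)
  qed
  note compat = this
  show ?thesis
    by (intro exI[of _ K] exI[of _ e] allI conjI ballI impI) (rule range zero compat Q; assumption?)+
qed

end

section \<open>Evaluation of restricted series modulo \<open>p\<^sup>n\<close>\<close>

text \<open>Overwrites the \<open>undefined\<close> values that an extensional
  \<open>\<beta>\<close> has from index \<open>m\<close> on.\<close>

definition mk_exponent :: "nat \<Rightarrow> (nat \<Rightarrow> nat) \<Rightarrow> nat \<Rightarrow> nat \<Rightarrow> nat" where
  "mk_exponent m \<beta> k = (\<lambda>i. if i < m then \<beta> i else if i = m then k else 0)"

lemma mk_exponent_inject:
  assumes "\<beta> \<in> extensional {..<m}" "\<beta>' \<in> extensional {..<m}"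
    "mk_exponent m \<beta> k = mk_exponent m \<beta>' k'"
  shows "\<beta> = \<beta>' \<and> k = k'"
proof
  show "\<beta> = \<beta>'"
  proof (rule extensionalityI[OF assms(1,2)])
    fix i assume "i \<in> {..<m}"
    then show "\<beta> i = \<beta>' i"
      using fun_cong[OF assms(3), of i] by (simp add: mk_exponent_def)
  qed
  show "k = k'"
    using fun_cong[OF assms(3), of m] by (simp add: mk_exponent_def)
qed

text \<open>Enlarging the support of \<open>c\<close> modulo \<open>p ^ n\<close> to a rectangle
  adds only zero terms and gives the double sum the shape of \<open>chart_subst\<close>.\<close>

lemma zp_eval_box:
  assumes S: "finite S" "S \<subseteq> extensional {..<m}"
    and support: "\<And>\<alpha>. c \<alpha> n \<noteq> 0 \<Longrightarrow> \<exists>\<beta>\<in>S. \<exists>k\<le>K. \<alpha> = mk_exponent m \<beta> k"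
  shows "zp_eval p c x n = (\<Sum>k\<le>K. \<Sum>\<beta>\<in>S. c (mk_exponent m \<beta> k) n
           * ((\<Prod>i<m. x i n ^ \<beta> i) * x m n ^ k)) mod p ^ n"
proof -
  define M where "M \<alpha> = (\<Prod>i\<in>{i. \<alpha> i \<noteq> 0}. x i n ^ \<alpha> i)" for \<alpha> :: "nat \<Rightarrow> nat"
  have M: "M (mk_exponent m \<beta> k) = (\<Prod>i<m. x i n ^ \<beta> i) * x m n ^ k" for \<beta> k
  proof -
    have "M (mk_exponent m \<beta> k) = (\<Prod>i\<le>m. x i n ^ mk_exponent m \<beta> k i)"
      unfolding M_def
      by (rule prod.mono_neutral_left) (auto simp: mk_exponent_def split: if_splits)
    also have "\<dots> = (\<Prod>i<m. x i n ^ mk_exponent m \<beta> k i) * x m n ^ mk_exponent m \<beta> k m"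
      by (simp flip: lessThan_Suc_atMost)
    finally show ?thesis
      by (simp add: mk_exponent_def)
  qed
  define h where "h = (\<lambda>(k, \<beta>). mk_exponent m \<beta> k)"
  have inj: "inj_on h ({..K} \<times> S)"
  proof -
    have "\<beta> = \<beta>' \<and> k = k'" if "\<beta> \<in> S" "\<beta>' \<in> S" "mk_exponent m \<beta> k = mk_exponent m \<beta>' k'" for \<beta> \<beta>' k k'
      using mk_exponent_inject[OF _ _ that(3)] that(1,2) S(2) by blast
    then show ?thesis
      unfolding inj_on_def h_def by clarsimp
  qed
  have "(\<Sum>\<alpha>\<in>{\<alpha>. c \<alpha> n \<noteq> 0}. c \<alpha> n * M \<alpha>) = (\<Sum>\<alpha>\<in>h ` ({..K} \<times> S). c \<alpha> n * M \<alpha>)"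
  proof (rule sum.mono_neutral_left)
    show "{\<alpha>. c \<alpha> n \<noteq> 0} \<subseteq> h ` ({..K} \<times> S)"
      using support by (force simp: h_def)
  qed (use S(1) in auto)
  also have "\<dots> = (\<Sum>k\<le>K. \<Sum>\<beta>\<in>S. c (mk_exponent m \<beta> k) n * M (mk_exponent m \<beta> k))"
    by (subst sum.reindex[OF inj]) (simp add: sum.cartesian_product h_def case_prod_unfold)
  finally show ?thesis
    by (simp only: zp_eval_def M_def[symmetric] M)
qed

lemma restricted_bounded:
  assumes "restricted c"
  shows "\<exists>K. \<forall>\<alpha>. c \<alpha> n \<noteq> 0 \<longrightarrow> \<alpha> m \<le> K"
proof -
  have "finite ((\<lambda>\<alpha>. \<alpha> m) ` {\<alpha>. c \<alpha> n \<noteq> 0})"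
    using assms by (simp add: restricted_def)
  then obtain K where "\<forall>k\<in>(\<lambda>\<alpha>. \<alpha> m) ` {\<alpha>. c \<alpha> n \<noteq> 0}. k \<le> K"
    by (auto simp: finite_nat_set_iff_bounded_le)
  then show ?thesis by auto
qed

lemma dvd_poly_diff:
  fixes q :: "'a::comm_ring_1 poly"
  assumes "d dvd x - y"
  shows "d dvd poly q x - poly q y"
proof (induction q)
  case (pCons a q)
  show ?case
    using dvd_diff_mult[OF assms pCons.IH] by simp
qed simp

section \<open>Residues of p-adic integers and of one-variable series\<close>

lemma ZpD:
  assumes "x \<in> Zp p"
  shows "0 \<le> x n" "x n < p ^ n" "x (Suc n) mod p ^ n = x n"
proof -
  have "0 \<le> x n \<and> x n < p ^ n \<and> x n = x (Suc n) mod p ^ n"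
    using assms unfolding Zp_def mem_Collect_eq by (rule spec)
  then show "0 \<le> x n" "x n < p ^ n" "x (Suc n) mod p ^ n = x n"
    by simp_all
qed

lemma Zp_mod:
  assumes "x \<in> Zp p" "n \<le> N"
  shows "x N mod p ^ n = x n"
  using assms(2)
proof (induction N rule: dec_induct)
  case base
  show ?case
    using ZpD(1,2)[OF assms(1)] by (rule mod_pos_pos_trivial)
next
  case (step N)
  have "p ^ n dvd p ^ N"
    using step.hyps by (simp add: le_imp_power_dvd)
  then show ?case
    using step.IH ZpD(3)[OF assms(1)] by (metis mod_mod_cancel)
qed

text \<open>Restrictedness makes the series a polynomial modulo each \<open>p ^ n\<close>; the
  polynomials are coherent because the coefficients are.\<close>

lemma one_variable_series_polys:
  assumes p: "p > 0" and c: "zp_series p 0 c" "restricted c"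
  shows "\<exists>Q. (\<forall>n. [:p ^ n:] dvd Q (Suc n) - Q n)
           \<and> (\<forall>u n. zp_eval p c (\<lambda>i. u) n = poly (Q n) (u n) mod p ^ n)"
proof -
  \<comment> \<open>The one extensional function on the empty index set, which lets the case
    \<open>m = 0\<close> of \<open>zp_eval_box\<close> apply.\<close>
  define e :: "nat \<Rightarrow> nat" where "e = (\<lambda>_. undefined)"
  define C where "C k = c (mk_exponent 0 e k)" for k
  obtain K where K: "\<And>n \<alpha>. c \<alpha> n \<noteq> 0 \<Longrightarrow> \<alpha> 0 \<le> K n"
  proof -
    have "\<forall>n. \<exists>K. \<forall>\<alpha>. c \<alpha> n \<noteq> 0 \<longrightarrow> \<alpha> 0 \<le> K"
      using restricted_bounded[OF c(2)] by (intro allI)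
    then show thesis
      using that by metis
  qed
  have C0: "C k n = 0" if "k > K n" for k n
    using K[of "mk_exponent 0 e k" n] that by (force simp: C_def mk_exponent_def)
  define Q where "Q n = (\<Sum>k\<le>K n. monom (C k n) k)" for n
  have coeffQ: "coeff (Q n) k = C k n" for n k
    using C0[of n k] by (auto simp: Q_def coeff_sum)
  have "[:p ^ n:] dvd Q (Suc n) - Q n" for n
  proof -
    have "C k (Suc n) mod p ^ n = C k n" for k
      using c(1) ZpD(3) by (simp add: zp_series_def C_def)
    then have "p ^ n dvd C k (Suc n) - C k n" for k
      by (metis dvd_minus_mod)
    then show ?thesis
      by (simp add: const_poly_dvd_iff coeffQ)
  qed
  moreover have "zp_eval p c (\<lambda>i. u) n = poly (Q n) (u n) mod p ^ n" for u n
  proof -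
    have "zp_eval p c (\<lambda>i. u) n = (\<Sum>k\<le>K n. \<Sum>\<beta>\<in>{e}. c (mk_exponent 0 \<beta> k) n
           * ((\<Prod>i<0. u n ^ \<beta> i) * u n ^ k)) mod p ^ n"
    proof (rule zp_eval_box)
      fix \<alpha> assume \<alpha>: "c \<alpha> n \<noteq> 0"
      then have "\<forall>i>0. \<alpha> i = 0"
        using c(1) by (auto simp: zp_series_def zp_zero_def)
      then have "\<alpha> = mk_exponent 0 e (\<alpha> 0)"
        by (auto simp: mk_exponent_def)
      with K[OF \<alpha>] show "\<exists>\<beta>\<in>{e}. \<exists>k\<le>K n. \<alpha> = mk_exponent 0 \<beta> k"
        by blast
    qed (auto simp: e_def)
    then show ?thesis
      by (simp add: Q_def poly_sum poly_monom C_def)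
  qed
  ultimately show ?thesis by blast
qed

section \<open>Iterates of \<open>delta\<close> on residues, and the decomposition into
  discs\<close>

lemma zp_of_int_in_Zp:
  assumes "p > 0"
  shows "zp_of_int p z \<in> Zp p"
  using assms by (auto simp: Zp_def zp_of_int_def mod_mod_cancel)

lemma delta_eq_fermat_quot:
  assumes "prime p"
  shows "delta p a n = fermat_quot p (a (Suc n)) mod p ^ n"
proof -
  have p: "p > 0" using assms by (rule prime_gt_0_int)
  have "delta p a n = (p * fermat_quot p (a (Suc n))) mod (p * p ^ n) div p"
    by (simp add: delta_def zp_divp_def zp_minus_def zp_pow_def mod_diff_right_eq
        fermat_quot_mult[OF assms])
  also have "\<dots> = fermat_quot p (a (Suc n)) mod p ^ n"
    using p by (simp add: mod_mult_mult1)
  finally show ?thesis .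
qed

text \<open>Each application of \<open>delta\<close> consumes one digit, hence \<open>n + i\<close>
  digits of \<open>a\<close> determine \<open>n\<close> digits of the result.\<close>

lemma delta_iterate_cong:
  assumes "prime p" "a \<in> Zp p" "n + i \<le> N"
  shows "p ^ n dvd (delta p ^^ i) a n - (fermat_quot p ^^ i) (a N)"
  using assms(3)
proof (induction i arbitrary: n)
  case 0
  then show ?case
    using Zp_mod[OF assms(2), of n N] Zp_mod[OF assms(2), of n n] by (simp flip: mod_eq_dvd_iff)
next
  case (Suc i)
  have "p ^ n dvd (delta p ^^ Suc i) a n - fermat_quot p ((delta p ^^ i) a (Suc n))"
    using assms(1) by (simp add: delta_eq_fermat_quot flip: mod_eq_dvd_iff)
  moreover have "p ^ n dvd fermat_quot p ((delta p ^^ i) a (Suc n)) - (fermat_quot p ^^ Suc i) (a N)"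
    using Suc.IH[of "Suc n"] Suc.prems assms(1) by (simp add: fermat_quot_cong)
  ultimately show ?case
    by (rule dvd_diff_trans)
qed

text \<open>Dropping the lowest \<open>m\<close> digits of \<open>a\<close> gives its coordinate
  \<open>u\<close> in the disc around the integer \<open>a m\<close>.\<close>

lemma Zp_disc_decomposition:
  fixes a :: zp and p :: int and m :: nat
  assumes "p > 0" "a \<in> Zp p"
  defines "u \<equiv> \<lambda>n. a (n + m) div p ^ m"
  shows "u \<in> Zp p" "a (n + m) = a m + p ^ m * u n"
    "zp_add p (zp_of_int p (a m)) (zp_mult p (zp_of_int p (p ^ m)) u) = a"
proof -
  have split: "a (n + m) = a m + p ^ m * u n" for n
    using Zp_mod[OF assms(2), of m "n + m"] by (simp add: u_def add.commute)
      (metis mod_mult_div_eq)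
  then show "a (n + m) = a m + p ^ m * u n" .
  show "zp_add p (zp_of_int p (a m)) (zp_mult p (zp_of_int p (p ^ m)) u) = a"
  proof
    fix n
    have "zp_add p (zp_of_int p (a m)) (zp_mult p (zp_of_int p (p ^ m)) u) n
        = (a m + p ^ m * u n) mod p ^ n"
      by (simp add: zp_add_def zp_of_int_def zp_mult_def mod_add_eq mod_mult_left_eq mod_add_left_eq
          mod_add_right_eq)
    then show "zp_add p (zp_of_int p (a m)) (zp_mult p (zp_of_int p (p ^ m)) u) n = a n"
      using Zp_mod[OF assms(2), of n "n + m"] by (simp flip: split)
  qed
  show "u \<in> Zp p"
    unfolding Zp_def
  proof (safe)
    fix n
    have a: "0 \<le> a (n + m)" "a (n + m) < p ^ (n + m)"
      using ZpD[OF assms(2)] by auto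
    with assms(1) show "0 \<le> u n"
      by (simp add: u_def pos_imp_zdiv_nonneg_iff)
    have "p ^ m * u n < p ^ m * p ^ n"
      using a(2) ZpD(1)[OF assms(2), of m] split[of n] by (simp add: power_add mult.commute)
    with assms(1) show "u n < p ^ n"
      by simp
    have "a (n + m) = a (Suc n + m) mod (p ^ m * p ^ n)"
      using Zp_mod[OF assms(2), of "n + m" "Suc n + m"] by (simp add: power_add mult.commute)
    also have "\<dots> = p ^ m * (u (Suc n) mod p ^ n) + a (Suc n + m) mod p ^ m"
      using assms(1) by (simp add: zmod_zmult2_eq u_def)
    also have "a (Suc n + m) mod p ^ m = a m"
      by (rule Zp_mod[OF assms(2)]) simp
    finally have "p ^ m * u n = p ^ m * (u (Suc n) mod p ^ n)"
      by (simp add: split)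
    with assms(1) show "u n = u (Suc n) mod p ^ n"
      by simp
  qed
qed

text \<open>Integer centres suffice, since every p-adic integer lies in the disc around its residue
  \<open>a m\<close>.\<close>

lemma analytic_level_polys:
  assumes p: "p > 0" and f: "analytic_level p m f"
  shows "\<exists>Q. (\<forall>n r. [:p ^ n:] dvd Q (Suc n) r - Q n r)
     \<and> (\<forall>a\<in>Zp p. \<forall>n. f a n = poly (Q n (a m)) (a (n + m) div p ^ m) mod p ^ n)"
proof -
  have "\<exists>Q. (\<forall>n. [:p ^ n:] dvd Q (Suc n) - Q n)
     \<and> (\<forall>u\<in>Zp p. \<forall>n. f (zp_add p (zp_of_int p r) (zp_mult p (zp_of_int p (p ^ m)) u)) n
          = poly (Q n) (u n) mod p ^ n)" for r
  proof -
    obtain c where c: "zp_series p 0 c" "restricted c"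
      "\<And>u. u \<in> Zp p \<Longrightarrow> f (zp_add p (zp_of_int p r) (zp_mult p (zp_of_int p (p ^ m)) u)) = zp_eval p c (\<lambda>i. u)"
      using f zp_of_int_in_Zp[OF p] unfolding analytic_level_def by blast
    show ?thesis
      using one_variable_series_polys[OF p c(1,2)] c(3) by auto
  qed
  then obtain Q where Q: "\<And>r n. [:p ^ n:] dvd Q r (Suc n) - Q r n"
    "\<And>r u n. u \<in> Zp p \<Longrightarrow> f (zp_add p (zp_of_int p r) (zp_mult p (zp_of_int p (p ^ m)) u)) n
          = poly (Q r n) (u n) mod p ^ n"
    by metis
  show ?thesis
  proof (intro exI[of _ "\<lambda>n r. Q r n"] conjI allI ballI)
    show "[:p ^ n:] dvd Q r (Suc n) - Q r n" for n r
      by (rule Q)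
    show "f a n = poly (Q (a m) n) (a (n + m) div p ^ m) mod p ^ n" if "a \<in> Zp p" for a n
      using Q(2)[OF Zp_disc_decomposition(1)[OF p that], of "a m" m n]
      by (simp add: Zp_disc_decomposition(3)[OF p that])
  qed
qed

section \<open>Expansion in iterated Fermat quotients\<close>

text \<open>\<open>disc_charts\<close> constrains the charts modulo \<open>p\<close>; evaluation
  modulo \<open>p ^ n\<close> rests on their exact values, added here.\<close>

locale fermat_charts = disc_charts p m R G "\<lambda>r i. (fermat_quot p ^^ i) r"
  for p m R G +
  assumes poly_chart: "i \<le> m \<Longrightarrow> poly (G r i) u = (fermat_quot p ^^ i) (r + p ^ m * u)"

lemma fermat_charts_exist:
  assumes "prime p"
  shows "\<exists>G. fermat_charts p m {0..<p ^ m} G"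
proof -
  have "\<forall>r i. i \<le> m \<longrightarrow> (\<exists>H. \<forall>u. (fermat_quot p ^^ i) (r + p ^ m * u)
                 = (fermat_quot p ^^ i) r + p ^ (m - i) * (u + p * poly H u))"
    using fermat_quot_iterate_disc[OF assms] by blast
  then obtain H where H: "\<And>r i u. i \<le> m \<Longrightarrow> (fermat_quot p ^^ i) (r + p ^ m * u)
                 = (fermat_quot p ^^ i) r + p ^ (m - i) * (u + p * poly (H r i) u)"
    by metis
  \<comment> \<open>The factor \<open>p ^ (m - i)\<close> makes the chart constant modulo
    \<open>p\<close> for \<open>i < m\<close> and becomes 1 at \<open>i = m\<close>, leaving a
    translation modulo \<open>p\<close>.\<close>
  define G where "G r i = [:(fermat_quot p ^^ i) r:] + [:p ^ (m - i):] * ([:0, 1:] + [:p:] * H r i)"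
    for r i
  have "fermat_charts p m {0..<p ^ m} G"
  proof
    fix r i assume "i < m"
    then have "[:p:] dvd [:p ^ (m - i):]"
      by (simp add: dvd_power)
    then show "[:p:] dvd G r i - [:(fermat_quot p ^^ i) r:]"
      unfolding G_def by (metis add_diff_cancel_left' dvd_mult2)
  next
    fix r
    have "G r m - [:(fermat_quot p ^^ m) r, 1:] = [:p:] * H r m"
      by (simp add: G_def)
    then show "[:p:] dvd G r m - [:(fermat_quot p ^^ m) r, 1:]"
      by (rule dvdI)
  qed (use assms fermat_quot_iterates_separate H in \<open>auto simp: G_def\<close>)
  then show ?thesis by blast
qed

context fermat_charts
begin

lemma mk_exponent_surj:
  assumes "\<And>i. i > m \<Longrightarrow> \<alpha> i = 0" "\<And>i. i < m \<Longrightarrow> \<alpha> i < nat p"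
  shows "restrict \<alpha> {..<m} \<in> B" "\<alpha> = mk_exponent m (restrict \<alpha> {..<m}) (\<alpha> m)"
  using assms by (auto simp: B_def mk_exponent_def)

text \<open>The residue \<open>a (n + m)\<close> has enough digits for all iterates up to the
  \<open>m\<close>-th and lies on the disc of \<open>a m\<close>, where the charts compute these
  iterates.\<close>

lemma zp_eval_delta:
  assumes a: "a \<in> Zp p"
    and support: "\<And>\<alpha>. c \<alpha> n \<noteq> 0 \<Longrightarrow> (\<forall>i>m. \<alpha> i = 0) \<and> (\<forall>i<m. \<alpha> i < nat p) \<and> \<alpha> m \<le> K"
  shows "zp_eval p c (\<lambda>i. (delta p ^^ i) a) n
     = poly (chart_subst K (\<lambda>k \<beta>. c (mk_exponent m \<beta> k) n) (a m)) (a (n + m) div p ^ m) mod p ^ n"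
proof -
  have "B \<subseteq> extensional {..<m}"
    by (simp add: B_def PiE_def)
  moreover have "\<exists>\<beta>\<in>B. \<exists>k\<le>K. \<alpha> = mk_exponent m \<beta> k" if "c \<alpha> n \<noteq> 0" for \<alpha>
    using mk_exponent_surj support[OF that] by blast
  ultimately have "zp_eval p c (\<lambda>i. (delta p ^^ i) a) n
      = (\<Sum>k\<le>K. \<Sum>\<beta>\<in>B. c (mk_exponent m \<beta> k) n
           * ((\<Prod>i<m. (delta p ^^ i) a n ^ \<beta> i) * (delta p ^^ m) a n ^ k)) mod p ^ n"
    by (rule zp_eval_box[OF finite_B])
  also have "\<dots> = (\<Sum>k\<le>K. \<Sum>\<beta>\<in>B. c (mk_exponent m \<beta> k) n
           * ((\<Prod>i<m. (fermat_quot p ^^ i) (a (n + m)) ^ \<beta> i)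
              * (fermat_quot p ^^ m) (a (n + m)) ^ k)) mod p ^ n"
    unfolding mod_eq_dvd_iff
    by (intro dvd_diff_sum dvd_diff_mult dvd_diff_prod dvd_diff_power
        delta_iterate_cong[OF prime a]) auto
  also have "\<dots> = poly (chart_subst K (\<lambda>k \<beta>. c (mk_exponent m \<beta> k) n) (a m)) (a (n + m) div p ^ m) mod p ^ n"
    by (simp add: chart_subst_def poly_sum poly_prod poly_power poly_chart
        flip: Zp_disc_decomposition(2)[OF p_pos a])
  finally show ?thesis .
qed

definition admissible :: "((nat \<Rightarrow> nat) \<Rightarrow> zp) \<Rightarrow> bool" where
  "admissible c \<longleftrightarrow> zp_series p m c \<and> restricted c
     \<and> (\<forall>\<alpha>. c \<alpha> \<noteq> zp_zero \<longrightarrow> (\<forall>i<m. \<alpha> i \<le> nat p - 1))"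

lemma admissible_support:
  assumes "admissible c" "c \<alpha> n \<noteq> 0"
  shows "(\<forall>i>m. \<alpha> i = 0) \<and> (\<forall>i<m. \<alpha> i < nat p)"
proof -
  have "c \<alpha> \<noteq> zp_zero"
    using assms(2) by (auto simp: zp_zero_def)
  moreover have "nat p > 0"
    using p_pos by simp
  ultimately show ?thesis
    using assms(1) unfolding admissible_def zp_series_def
    by (metis Suc_pred less_Suc_eq_le One_nat_def)
qed

text \<open>The polynomials representing \<open>f\<close> on the discs are coherent in the
  precision, so their preimages under substitution are coherent too and assemble into p-adic
  coefficients.\<close>

lemma series_exists:
  assumes "analytic_level p m f"
  shows "\<exists>c. admissible c \<and> (\<forall>a\<in>Zp p. f a = zp_eval p c (\<lambda>i. (delta p ^^ i) a))"
proof -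
  obtain Q where Q: "\<And>n r. [:p ^ n:] dvd Q (Suc n) r - Q n r"
    and f: "\<And>a n. a \<in> Zp p \<Longrightarrow> f a n = poly (Q n (a m)) (a (n + m) div p ^ m) mod p ^ n"
    using analytic_level_polys[OF p_pos assms] by blast
  obtain K e where range: "\<And>N n \<beta>. e N n \<beta> \<in> {0..<p ^ N}"
    and zero: "\<And>N n \<beta>. n > K N \<Longrightarrow> e N n \<beta> = 0"
    and compat: "\<And>N n \<beta>. \<beta> \<in> B \<Longrightarrow> e N n \<beta> = e (Suc N) n \<beta> mod p ^ N"
    and e: "\<And>N r. r \<in> R \<Longrightarrow> [:p ^ N:] dvd Q N r - chart_subst (K N) (e N) r"
    using chart_subst_surjective_coherent[of Q, OF Q] by metis
  define A where "A = {\<alpha>::nat \<Rightarrow> nat. (\<forall>i>m. \<alpha> i = 0) \<and> (\<forall>i<m. \<alpha> i < nat p)}"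
  \<comment> \<open>For fixed \<open>\<alpha>\<close> this is a residue sequence in
    \<open>N\<close>; \<open>compat\<close> is exactly its coherence.\<close>
  define c where "c \<alpha> N = (if \<alpha> \<in> A then e N (\<alpha> m) (restrict \<alpha> {..<m}) else 0)" for \<alpha> N
  have support: "(\<forall>i>m. \<alpha> i = 0) \<and> (\<forall>i<m. \<alpha> i < nat p) \<and> \<alpha> m \<le> K N" if "c \<alpha> N \<noteq> 0" for \<alpha> N
    using that zero[of N "\<alpha> m"] by (force simp: c_def A_def split: if_splits)
  have c_mk: "c (mk_exponent m \<beta> k) N = e N k \<beta>" if "\<beta> \<in> B" for \<beta> k N
  proof -
    have "restrict (mk_exponent m \<beta> k) {..<m} = \<beta>"
      using that by (auto simp: B_def PiE_iff mk_exponent_def extensional_def)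
    moreover have "mk_exponent m \<beta> k \<in> A"
      using that by (auto simp: A_def B_def mk_exponent_def)
    ultimately show ?thesis
      by (simp add: c_def) (simp add: mk_exponent_def)
  qed
  have "c \<alpha> \<in> Zp p" for \<alpha>
  proof (cases "\<alpha> \<in> A")
    case True
    then have "restrict \<alpha> {..<m} \<in> B"
      using mk_exponent_surj(1) by (simp add: A_def)
    then have "e n (\<alpha> m) (restrict \<alpha> {..<m}) = e (Suc n) (\<alpha> m) (restrict \<alpha> {..<m}) mod p ^ n" for n
      by (rule compat)
    moreover have "c \<alpha> = (\<lambda>n. e n (\<alpha> m) (restrict \<alpha> {..<m}))"
      using True by (simp add: c_def fun_eq_iff)
    moreover have "e n (\<alpha> m) (restrict \<alpha> {..<m}) \<ge> 0 \<and> e n (\<alpha> m) (restrict \<alpha> {..<m}) < p ^ n" for n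
      using range[of n "\<alpha> m" "restrict \<alpha> {..<m}"] by simp
    ultimately show ?thesis
      unfolding Zp_def mem_Collect_eq by metis
  next
    case False
    then show ?thesis
      using p_pos by (simp add: Zp_def c_def[abs_def])
  qed
  moreover have "restricted c"
    unfolding restricted_def
  proof
    fix N
    have "{\<alpha>. c \<alpha> N \<noteq> 0} \<subseteq> (\<lambda>(\<beta>, k). mk_exponent m \<beta> k) ` (B \<times> {..K N})"
    proof
      fix \<alpha> assume "\<alpha> \<in> {\<alpha>. c \<alpha> N \<noteq> 0}"
      then have *: "(\<forall>i>m. \<alpha> i = 0) \<and> (\<forall>i<m. \<alpha> i < nat p)" "\<alpha> m \<le> K N"
        using support by blast+
      then show "\<alpha> \<in> (\<lambda>(\<beta>, k). mk_exponent m \<beta> k) ` (B \<times> {..K N})"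
        using mk_exponent_surj[of \<alpha>] by (intro image_eqI[of _ _ "(restrict \<alpha> {..<m}, \<alpha> m)"]) auto
    qed
    then show "finite {\<alpha>. c \<alpha> N \<noteq> 0}"
      by (rule finite_subset) (simp add: finite_B)
  qed
  moreover have "c \<alpha> = zp_zero" if "\<exists>i>m. \<alpha> i \<noteq> 0" for \<alpha>
    using that unfolding zp_zero_def by (intro ext) (auto simp: c_def A_def)
  moreover have "\<forall>i<m. \<alpha> i \<le> nat p - 1" if "c \<alpha> \<noteq> zp_zero" for \<alpha>
  proof -
    have "\<alpha> \<in> A"
      using that by (auto simp: c_def[abs_def] zp_zero_def split: if_splits)
    then show ?thesis by (force simp: A_def)
  qed
  ultimately have "admissible c"
    by (auto simp: admissible_def zp_series_def)
  moreover have "f a = zp_eval p c (\<lambda>i. (delta p ^^ i) a)" if a: "a \<in> Zp p" for a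
  proof
    fix N
    have "a m \<in> R"
      using ZpD[OF a] by (auto simp: R_def)
    then have "f a N = poly (chart_subst (K N) (e N) (a m)) (a (N + m) div p ^ m) mod p ^ N"
      using const_dvd_poly[OF e, of "a m"] by (simp add: f[OF a] mod_eq_dvd_iff)
    also have "chart_subst (K N) (e N) (a m) = chart_subst (K N) (\<lambda>k \<beta>. c (mk_exponent m \<beta> k) N) (a m)"
      by (simp add: chart_subst_def c_mk)
    finally show "f a N = zp_eval p c (\<lambda>i. (delta p ^^ i) a) N"
      using zp_eval_delta[OF a support] by simp
  qed
  ultimately show ?thesis by blast
qed

text \<open>On each disc the difference of the two series gives coherent polynomials that vanish at
  all integers modulo \<open>p ^ n\<close>. They are zero modulo \<open>p ^ n\<close>, and
  injectivity of substitution carries this back to the coefficients.\<close>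

lemma series_unique:
  assumes c: "admissible c" and c': "admissible c'"
    and eq: "\<And>a. a \<in> Zp p \<Longrightarrow>
      zp_eval p c (\<lambda>i. (delta p ^^ i) a) = zp_eval p c' (\<lambda>i. (delta p ^^ i) a)"
  shows "c = c'"
proof (intro ext)
  fix \<alpha> N
  have Zp: "c \<alpha> \<in> Zp p" "c' \<alpha> \<in> Zp p" for \<alpha>
    using c c' by (auto simp: admissible_def zp_series_def)
  have "\<exists>K. \<forall>\<alpha>. (c \<alpha> n \<noteq> 0 \<longrightarrow> \<alpha> m \<le> K) \<and> (c' \<alpha> n \<noteq> 0 \<longrightarrow> \<alpha> m \<le> K)" for n
    using restricted_bounded[of c n m] restricted_bounded[of c' n m] c c'
    unfolding admissible_def by (meson le_trans nat_le_linear)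
  then obtain K where K: "\<And>n \<alpha>. c \<alpha> n \<noteq> 0 \<Longrightarrow> \<alpha> m \<le> K n" "\<And>n \<alpha>. c' \<alpha> n \<noteq> 0 \<Longrightarrow> \<alpha> m \<le> K n"
    by metis
  define D where "D n k \<beta> = c (mk_exponent m \<beta> k) n - c' (mk_exponent m \<beta> k) n" for n k \<beta>
  have D0: "D n k \<beta> = 0" if "k > K n" for n k \<beta>
    using that K[of "mk_exponent m \<beta> k" n] by (force simp: D_def mk_exponent_def)
  have "[:p ^ n:] dvd chart_subst (K n) (D n) r" if r: "r \<in> R" for r n
  proof (rule coherent_polys_identity[where R = "\<lambda>n. chart_subst (K n) (D n) r", OF p_pos])
    fix n
    define K' where "K' = max (K n) (K (Suc n))"
    have "[:p ^ n:] dvd chart_subst K' (D (Suc n)) r - chart_subst K' (D n) r"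
    proof (rule chart_subst_cong_dvd)
      fix k \<beta>
      define \<gamma> where "\<gamma> = mk_exponent m \<beta> k"
      have "p ^ n dvd c \<gamma> (Suc n) - c \<gamma> n" "p ^ n dvd c' \<gamma> (Suc n) - c' \<gamma> n"
        using Zp_mod[OF Zp(1), of n "Suc n" \<gamma>] Zp_mod[OF Zp(1), of n n \<gamma>]
          Zp_mod[OF Zp(2), of n "Suc n" \<gamma>] Zp_mod[OF Zp(2), of n n \<gamma>]
        by (simp_all flip: mod_eq_dvd_iff)
      from dvd_diff[OF this] show "p ^ n dvd D (Suc n) k \<beta> - D n k \<beta>"
        by (simp add: D_def algebra_simps flip: \<gamma>_def)
    qed
    moreover have "chart_subst K' (D n) r = chart_subst (K n) (D n) r"
      by (rule chart_subst_mono) (use D0 in \<open>auto simp: K'_def\<close>)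
    moreover have "chart_subst K' (D (Suc n)) r = chart_subst (K (Suc n)) (D (Suc n)) r"
      by (rule chart_subst_mono) (use D0 in \<open>auto simp: K'_def\<close>)
    ultimately show "[:p ^ n:] dvd chart_subst (K (Suc n)) (D (Suc n)) r - chart_subst (K n) (D n) r"
      by simp
  next
    fix n x
    \<comment> \<open>Integer points of the disc around \<open>r\<close> are enough:
      \<open>a\<close> has disc coordinate \<open>x\<close>, seen modulo \<open>p ^ n\<close> at
      precision \<open>n + m\<close>.\<close>
    define a where "a = zp_of_int p (r + p ^ m * x)"
    have a: "a \<in> Zp p"
      unfolding a_def by (rule zp_of_int_in_Zp[OF p_pos])
    have am: "a m = r"
      using r by (simp add: a_def zp_of_int_def R_def)
    have "a (n + m) = r + p ^ m * (x mod p ^ n)"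
    proof -
      have "a (n + m) = (r + p ^ m * x) mod (p ^ m * p ^ n)"
        by (simp add: a_def zp_of_int_def power_add mult.commute)
      also have "\<dots> = p ^ m * ((r + p ^ m * x) div p ^ m mod p ^ n) + (r + p ^ m * x) mod p ^ m"
        using p_pos by (subst zmod_zmult2_eq) auto
      finally show ?thesis
        using r p_pos by (simp add: R_def)
    qed
    then have u: "a (n + m) div p ^ m = x mod p ^ n"
      using r p_pos by (simp add: R_def)
    have "zp_eval p c (\<lambda>i. (delta p ^^ i) a) n
      = poly (chart_subst (K n) (\<lambda>k \<beta>. c (mk_exponent m \<beta> k) n) r) (x mod p ^ n) mod p ^ n"
      using zp_eval_delta[OF a, of c n "K n"] admissible_support[OF c] K(1) am u by auto
    moreover have "zp_eval p c' (\<lambda>i. (delta p ^^ i) a) n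
      = poly (chart_subst (K n) (\<lambda>k \<beta>. c' (mk_exponent m \<beta> k) n) r) (x mod p ^ n) mod p ^ n"
      using zp_eval_delta[OF a, of c' n "K n"] admissible_support[OF c'] K(2) am u by auto
    ultimately have "poly (chart_subst (K n) (\<lambda>k \<beta>. c (mk_exponent m \<beta> k) n) r) (x mod p ^ n) mod p ^ n
      = poly (chart_subst (K n) (\<lambda>k \<beta>. c' (mk_exponent m \<beta> k) n) r) (x mod p ^ n) mod p ^ n"
      using eq[OF a] by simp
    then have "p ^ n dvd poly (chart_subst (K n) (D n) r) (x mod p ^ n)"
      by (simp add: D_def[abs_def] chart_subst_diff mod_eq_dvd_iff)
    moreover have "p ^ n dvd poly (chart_subst (K n) (D n) r) x - poly (chart_subst (K n) (D n) r) (x mod p ^ n)"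
      by (rule dvd_poly_diff) (simp flip: mod_eq_dvd_iff)
    ultimately show "p ^ n dvd poly (chart_subst (K n) (D n) r) x"
      by (metis dvd_diff_left_iff)
  qed
  then have D: "p ^ N dvd D N k \<beta>" if "k \<le> K N" "\<beta> \<in> B" for k \<beta>
    using chart_subst_injective that by blast
  show "c \<alpha> N = c' \<alpha> N"
  proof (cases "c \<alpha> N = 0 \<and> c' \<alpha> N = 0")
    case False
    then have *: "(\<forall>i>m. \<alpha> i = 0) \<and> (\<forall>i<m. \<alpha> i < nat p)" "\<alpha> m \<le> K N"
      using admissible_support[OF c] admissible_support[OF c'] K by blast+
    then have "p ^ N dvd D N (\<alpha> m) (restrict \<alpha> {..<m})"
      using D mk_exponent_surj(1) by blast
    then have "p ^ N dvd c \<alpha> N - c' \<alpha> N"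
      using mk_exponent_surj(2)[of \<alpha>] * by (simp add: D_def)
    \<comment> \<open>Both sides are canonical residues modulo \<open>p ^ N\<close>, so their
      congruence is equality.\<close>
    then show ?thesis
      using Zp_mod[OF Zp(1), of N N \<alpha>] Zp_mod[OF Zp(2), of N N \<alpha>]
      by (simp flip: mod_eq_dvd_iff)
  qed simp
qed

end

theorem theorem5p1:
  fixes p :: int and m :: nat and f :: "zp \<Rightarrow> zp"
  assumes "prime p"
    and "\<forall>a\<in>Zp p. f a \<in> Zp p"
    and "analytic_level p m f"
  shows "\<exists>!c. zp_series p m c \<and> restricted c
           \<and> (\<forall>\<alpha>. c \<alpha> \<noteq> zp_zero \<longrightarrow> (\<forall>i<m. \<alpha> i \<le> nat p - 1))
           \<and> (\<forall>a\<in>Zp p. f a = zp_eval p c (\<lambda>i. (delta p ^^ i) a))"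
proof -
  obtain G where "fermat_charts p m {0..<p ^ m} G"
    using fermat_charts_exist[OF assms(1)] by blast
  then interpret fermat_charts p m "{0..<p ^ m}" G .
  have "\<exists>!c. admissible c \<and> (\<forall>a\<in>Zp p. f a = zp_eval p c (\<lambda>i. (delta p ^^ i) a))"
  proof (rule ex_ex1I[OF series_exists[OF assms(3)]])
    fix c c'
    assume "admissible c \<and> (\<forall>a\<in>Zp p. f a = zp_eval p c (\<lambda>i. (delta p ^^ i) a))"
      "admissible c' \<and> (\<forall>a\<in>Zp p. f a = zp_eval p c' (\<lambda>i. (delta p ^^ i) a))"
    then show "c = c'"
      by (intro series_unique) auto
  qed
  then show ?thesis
    by (simp only: admissible_def conj_assoc)
qed

end
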